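(* Let $n_1\ge n_2\ge n_3$ and let $\mathcal{F}\in\mathbb{C}^{n_1\times n_2\times n_3}$ be an order-3 tensor with rank $r$, where $n_2<r\le n_1$. Let $\mathcal{T}\in\mathbb{C}^{r\times n_2\times n_3}$ be the reduced tensor of $\mathcal{F}$, with slices $T_k=\mathcal{T}_{:,:,k}\in\mathbb{C}^{r\times n_2}$, $k=1,\dots,n_3$. In the generic case: (i) for each nonsingular generalized left common eigenmatrix $S\in\mathbb{C}^{r\times r}$ of $T_2,\dots,T_{n_3}$, say $ST_k=D_kS_{:,1:n_2}$ with $D_k$ diagonal for $2\le k\le n_3$, the tensor $\mathcal{F}$ has a tensor decomposition $$\mathcal{F}=U^{(1)}\circ U^{(2)}\circ U^{(3)},$$ where $U^{(2)}=(S_{:,1:n_2})^\top\in\mathbb{C}^{n_2\times r}$, $U^{(3)}\in\mathbb{C}^{n_3\times r}$ has entries $U^{(3)}_{1,i}=1$ and $U^{(3)}_{k,i}=(D_k)_{i,i}$ for $2\le k\le n_3$, $1\le i\le r$, and $U^{(1)}\in\mathbb{C}^{n_1\times r}$ is such that $X=(U^{(1)})^\top$ is a solution of the linear least squares system $(U^{(2)}\odot U^{(3)})X=\mathrm{Flatten}(\mathcal{F},1)^\top$; (ii) for each tensor decomposition $\mathcal{F}=V^{(1)}\circ V^{(2)}\circ V^{(3)}$ (with $V^{(j)}\in\mathbb{C}^{n_j\times r}$) there is a nonsingular generalized left common eigenmatrix $S$ of $T_2,\dots,T_{n_3}$.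
   Context: Notation. For matrices $U^{(j)}$ with $r$ columns, $U^{(1)}\circ U^{(2)}\circ U^{(3)}:=\sum_{s=1}^r U^{(1)}_{:,s}\otimes U^{(2)}_{:,s}\otimes U^{(3)}_{:,s}$, where $(u\otimes v\otimes w)_{i_1,i_2,i_3}=u_{i_1}v_{i_2}w_{i_3}$. The rank of a tensor is the smallest number of rank-1 tensors $u\otimes v\otimes w$ summing to it; a tensor decomposition of a rank-$r$ tensor is an expression of it as a sum of $r$ rank-1 tensors. $S_{:,1:n}$ denotes the first $n$ columns of $S$. For $A=(a_1,\dots,a_r)$ and $B=(b_1,\dots,b_r)$, $A\odot B:=(b_1\boxtimes a_1,\dots,b_r\boxtimes a_r)$, with $\boxtimes$ the Kronecker product. $\mathrm{Flatten}(\mathcal{F},1)\in\mathbb{C}^{n_1\times n_2n_3}$ has entries $\mathrm{Flatten}(\mathcal{F},1)_{i_1,\,1+(i_2-1)+(i_3-1)n_2}=\mathcal{F}_{i_1,i_2,i_3}$. Reduced tensor. In the generic case the matrix $\mathcal{F}_{1:r,:,1}\in\mathbb{C}^{r\times n_2}$ has full column rank. Choose any $C\in\mathbb{C}^{r\times(r-n_2)}$ such that $\hat F=(\mathcal{F}_{1:r,:,1}\ \ C)\in\mathbb{C}^{r\times r}$ is nonsingular, and put $P=\hat F^{-1}$, so that $P\mathcal{F}_{1:r,:,1}=(I_r)_{:,1:n_2}$. The reduced tensor is $\mathcal{T}:=P\times_1\mathcal{F}_{1:r,:,:}$, i.e. $\mathcal{T}_{:,:,k}=P\,\mathcal{F}_{1:r,:,k}$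 for $1\le k\le n_3$. In particular $T_1=(I_r)_{:,1:n_2}$. Generalized left common eigenmatrix. For matrices $A_1,\dots,A_d\in\mathbb{C}^{m\times n}$ with $m\ge n$, a full rank matrix $S\in\mathbb{C}^{m\times m}$ is a generalized left common eigenmatrix of $A_1,\dots,A_d$ if there are diagonal matrices $D_k\in\mathbb{C}^{m\times m}$ with $SA_k=D_kS_{:,1:n}$ for $1\le k\le d$. "In the generic case" means: there is a nonempty Zariski open subset $\mathcal{U}$ of $\mathbb{C}^{n_1\times r}\times\mathbb{C}^{n_2\times r}\times\mathbb{C}^{n_3\times r}$ such that the conclusions hold for every tensor $\mathcal{F}$ of rank $r$ of the form $\mathcal{F}=W^{(1)}\circ W^{(2)}\circ W^{(3)}$ with $(W^{(1)},W^{(2)},W^{(3)})\in\mathcal{U}$ (and any admissible choice of $C$). *)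

theory Defs
  imports
    Complex_Main
    "Jordan_Normal_Form.Gauss_Jordan_Elimination"
    "Jordan_Normal_Form.DL_Rank"
begin

text \<open>All indices are 0-based: the index $i$ of the usual 1-based notation is $i - 1$ here.
  An order-3 tensor of format $n_1 \times n_2 \times n_3$ is a function of three indices
  extended by 0 outside its format, so that equality of tensors is equality of functions.\<close>

type_synonym tensor3 = "nat \<Rightarrow> nat \<Rightarrow> nat \<Rightarrow> complex"

definition tensor_carrier :: "nat \<Rightarrow> nat \<Rightarrow> nat \<Rightarrow> tensor3 set" where
  "tensor_carrier n1 n2 n3 =
     {F. \<forall>i j k. \<not> (i < n1 \<and> j < n2 \<and> k < n3) \<longrightarrow> F i j k = 0}"

definition outer3 :: "complex vec \<Rightarrow> complex vec \<Rightarrow> complex vec \<Rightarrow> tensor3" where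
  "outer3 u v w = (\<lambda>i j k. if i < dim_vec u \<and> j < dim_vec v \<and> k < dim_vec w
                           then u $ i * v $ j * w $ k else 0)"

definition cp_tensor :: "complex mat \<Rightarrow> complex mat \<Rightarrow> complex mat \<Rightarrow> tensor3" where
  "cp_tensor U1 U2 U3 =
     (\<lambda>i j k. \<Sum>s<dim_col U1. outer3 (col U1 s) (col U2 s) (col U3 s) i j k)"

definition rank_one_tensor :: "nat \<Rightarrow> nat \<Rightarrow> nat \<Rightarrow> tensor3 \<Rightarrow> bool" where
  "rank_one_tensor n1 n2 n3 G \<longleftrightarrow>
     (\<exists>u v w. u \<in> carrier_vec n1 \<and> v \<in> carrier_vec n2 \<and> w \<in> carrier_vec n3 \<and>
        u \<noteq> 0\<^sub>v n1 \<and> v \<noteq> 0\<^sub>v n2 \<and> w \<noteq> 0\<^sub>v n3 \<and> G = outer3 u v w)"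

definition tensor_rank :: "nat \<Rightarrow> nat \<Rightarrow> nat \<Rightarrow> tensor3 \<Rightarrow> nat" where
  "tensor_rank n1 n2 n3 F =
     (LEAST m. \<exists>G :: nat \<Rightarrow> tensor3. (\<forall>s<m. rank_one_tensor n1 n2 n3 (G s)) \<and>
        F = (\<lambda>i j k. \<Sum>s<m. G s i j k))"

text \<open>A decomposition has exactly as many rank-one summands as the rank of the tensor.\<close>

definition tensor_decomposition ::
  "nat \<Rightarrow> nat \<Rightarrow> nat \<Rightarrow> tensor3 \<Rightarrow> complex mat \<Rightarrow> complex mat \<Rightarrow> complex mat \<Rightarrow> bool" where
  "tensor_decomposition n1 n2 n3 F U1 U2 U3 \<longleftrightarrow>
     (let r = tensor_rank n1 n2 n3 F in
        U1 \<in> carrier_mat n1 r \<and> U2 \<in> carrier_mat n2 r \<and> U3 \<in> carrier_mat n3 r \<and>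
        (\<forall>s<r. rank_one_tensor n1 n2 n3 (outer3 (col U1 s) (col U2 s) (col U3 s))) \<and>
        F = cp_tensor U1 U2 U3)"

definition frontal_slice :: "nat \<Rightarrow> nat \<Rightarrow> tensor3 \<Rightarrow> nat \<Rightarrow> complex mat" where
  "frontal_slice m n F k = mat m n (\<lambda>(i, j). F i j k)"

text \<open>Only the first \<open>dim_col P\<close> horizontal slices of \<open>F\<close> enter, so for an
  $r \times r$ matrix \<open>P\<close> this is $P \times_1 \mathcal{F}_{1:r,:,:}$.\<close>

definition mode1_product :: "complex mat \<Rightarrow> tensor3 \<Rightarrow> tensor3" where
  "mode1_product P F =
     (\<lambda>i j k. if i < dim_row P then \<Sum>l<dim_col P. P $$ (i, l) * F l j k else 0)"

definition flatten1 :: "nat \<Rightarrow> nat \<Rightarrow> nat \<Rightarrow> tensor3 \<Rightarrow> complex mat" where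
  "flatten1 n1 n2 n3 F = mat n1 (n2 * n3) (\<lambda>(i, c). F i (c mod n2) (c div n2))"

definition first_cols :: "nat \<Rightarrow> 'a mat \<Rightarrow> 'a mat" where
  "first_cols n S = mat (dim_row S) n (\<lambda>(i, j). S $$ (i, j))"

definition append_cols :: "'a mat \<Rightarrow> 'a mat \<Rightarrow> 'a mat" where
  "append_cols A C = mat (dim_row A) (dim_col A + dim_col C)
     (\<lambda>(i, j). if j < dim_col A then A $$ (i, j) else C $$ (i, j - dim_col A))"

definition kron_vec :: "complex vec \<Rightarrow> complex vec \<Rightarrow> complex vec" where
  "kron_vec v w = vec (dim_vec v * dim_vec w) (\<lambda>i. v $ (i div dim_vec w) * w $ (i mod dim_vec w))"

text \<open>Note the order of the factors: column $s$ is $b_s \boxtimes a_s$.\<close>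

definition khatri_rao :: "complex mat \<Rightarrow> complex mat \<Rightarrow> complex mat" where
  "khatri_rao A B = mat_of_cols (dim_row B * dim_row A)
     (map (\<lambda>s. kron_vec (col B s) (col A s)) [0..<dim_col A])"

definition frobenius_norm :: "complex mat \<Rightarrow> real" where
  "frobenius_norm A = sqrt (\<Sum>i<dim_row A. \<Sum>j<dim_col A. (cmod (A $$ (i, j)))\<^sup>2)"

definition least_squares_solution :: "complex mat \<Rightarrow> complex mat \<Rightarrow> complex mat \<Rightarrow> bool" where
  "least_squares_solution A B X \<longleftrightarrow>
     X \<in> carrier_mat (dim_col A) (dim_col B) \<and>
     (\<forall>Y \<in> carrier_mat (dim_col A) (dim_col B).
        frobenius_norm (A * X - B) \<le> frobenius_norm (A * Y - B))"

definition F_hat :: "nat \<Rightarrow> nat \<Rightarrow> tensor3 \<Rightarrow> complex mat \<Rightarrow> complex mat" where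
  "F_hat r n2 F C = append_cols (frontal_slice r n2 F 0) C"

text \<open>Meaningful only when \<open>F_hat r n2 F C\<close> is invertible.\<close>

definition reduced_tensor :: "nat \<Rightarrow> nat \<Rightarrow> tensor3 \<Rightarrow> complex mat \<Rightarrow> tensor3" where
  "reduced_tensor r n2 F C = mode1_product (the (mat_inverse (F_hat r n2 F C))) F"

definition eigenmatrix_relation ::
  "nat \<Rightarrow> nat \<Rightarrow> nat set \<Rightarrow> (nat \<Rightarrow> complex mat) \<Rightarrow> complex mat \<Rightarrow> (nat \<Rightarrow> complex mat) \<Rightarrow> bool"
where
  "eigenmatrix_relation m n K A S D \<longleftrightarrow>
     (\<forall>k\<in>K. D k \<in> carrier_mat m m \<and> diagonal_mat (D k) \<and> S * A k = D k * first_cols n S)"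

text \<open>The matrices $A_k$, $k \in K$, are $m \times n$ with $m \geq n$.\<close>

definition gen_left_common_eigenmatrix ::
  "nat \<Rightarrow> nat \<Rightarrow> nat set \<Rightarrow> (nat \<Rightarrow> complex mat) \<Rightarrow> complex mat \<Rightarrow> bool" where
  "gen_left_common_eigenmatrix m n K A S \<longleftrightarrow>
     S \<in> carrier_mat m m \<and> vec_space.rank m S = m \<and>
     (\<exists>D. eigenmatrix_relation m n K A S D)"

definition factor_space ::
  "nat \<Rightarrow> nat \<Rightarrow> nat \<Rightarrow> nat \<Rightarrow> (complex mat \<times> complex mat \<times> complex mat) set" where
  "factor_space n1 n2 n3 r = carrier_mat n1 r \<times> carrier_mat n2 r \<times> carrier_mat n3 r"

text \<open>Polynomial functions in the entries of the three factor matrices.\<close>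

inductive_set factor_polys ::
  "nat \<Rightarrow> nat \<Rightarrow> nat \<Rightarrow> nat \<Rightarrow> (complex mat \<times> complex mat \<times> complex mat \<Rightarrow> complex) set"
  for n1 n2 n3 r :: nat
where
  const: "(\<lambda>_. c) \<in> factor_polys n1 n2 n3 r"
| coord1: "i < n1 \<Longrightarrow> s < r \<Longrightarrow> (\<lambda>(W1, W2, W3). W1 $$ (i, s)) \<in> factor_polys n1 n2 n3 r"
| coord2: "i < n2 \<Longrightarrow> s < r \<Longrightarrow> (\<lambda>(W1, W2, W3). W2 $$ (i, s)) \<in> factor_polys n1 n2 n3 r"
| coord3: "i < n3 \<Longrightarrow> s < r \<Longrightarrow> (\<lambda>(W1, W2, W3). W3 $$ (i, s)) \<in> factor_polys n1 n2 n3 r"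
| add: "p \<in> factor_polys n1 n2 n3 r \<Longrightarrow> q \<in> factor_polys n1 n2 n3 r \<Longrightarrow>
          (\<lambda>W. p W + q W) \<in> factor_polys n1 n2 n3 r"
| mult: "p \<in> factor_polys n1 n2 n3 r \<Longrightarrow> q \<in> factor_polys n1 n2 n3 r \<Longrightarrow>
          (\<lambda>W. p W * q W) \<in> factor_polys n1 n2 n3 r"

definition zariski_open ::
  "nat \<Rightarrow> nat \<Rightarrow> nat \<Rightarrow> nat \<Rightarrow> (complex mat \<times> complex mat \<times> complex mat) set \<Rightarrow> bool" where
  "zariski_open n1 n2 n3 r U \<longleftrightarrow>
     (\<exists>P \<subseteq> factor_polys n1 n2 n3 r.
        U = factor_space n1 n2 n3 r - {W. \<forall>p\<in>P. p W = 0})"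

end

theory Submission
  imports Defs
begin

text \<open>Let A be the block of the first r rows of W1, and d_k the diagonal matrix of row k of
  W3. The first r rows of slice k of F form A d_k W2^T (\<open>frontal_slice_F\<close>). Genericity
  means three open conditions: A is nonsingular, the first n2 columns of W2 form a nonsingular
  matrix, and row 0 of W3 has no zero. Their product is one polynomial,
  \<open>genericity_poly\<close>, nonzero at an explicit point; the open set is where it does not
  vanish. There A and d_0 are invertible and W2^T has a left inverse, so slice 0 has rank n2.

  Reduction by P only replaces A by PA, again invertible, and turns slice 0 into the first n2
  columns of the identity (\<open>reduced_tensorE\<close>).

  For (i), the relations S T_k = D_k U2^T for k >= 1, together with the automatic S T_0 = U2^T, say
  slice by slice that the tensor with factors SPA, W2, W3 equals the one with factors 1, U2, U3.
  Multiplying in mode 1 by W1 (SPA)^-1 gives F with factors U1, U2, U3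
  (\<open>decomposition_of_eigenmatrix\<close>). Hence the least squares system is consistent, its
  solutions are exact, and exact solutions are the same as decompositions with factors U2, U3
  (\<open>least_squares_decomposition\<close>).

  For (ii), S = (PA d_0)^-1 satisfies S T_k = d_0^-1 d_k W2^T. The case k = 0 identifies W2^T as the
  first n2 columns of S, so S is a common eigenmatrix (\<open>eigenmatrix_exists\<close>).\<close>

section \<open>Inverses and rank of matrices\<close>

lemma invertible_mat_inverseE:
  assumes "invertible_mat A" and "A \<in> carrier_mat n n"
  obtains B where "B \<in> carrier_mat n n" "A * B = 1\<^sub>m n" "B * A = 1\<^sub>m n"
proof -
  obtain B where AB: "A * B = 1\<^sub>m (dim_row A)" and BA: "B * A = 1\<^sub>m (dim_row B)"
    using assms(1) unfolding invertible_mat_def inverts_mat_def by blast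
  \<comment> \<open>\<open>inverts_mat\<close> prescribes no format for \<open>B\<close>; its
    dimensions are read off from the two products.\<close>
  have "dim_col B = n" using arg_cong[OF AB, of dim_col] assms(2) by simp
  moreover have "dim_row B = n" using arg_cong[OF BA, of dim_col] assms(2) by simp
  ultimately show thesis using that[of B] AB BA assms(2) by auto
qed

lemma invertible_matI:
  fixes A :: "'a :: field mat"
  assumes "A \<in> carrier_mat n n" and "B \<in> carrier_mat n n" and "A * B = 1\<^sub>m n"
  shows "invertible_mat A"
  using mat_mult_left_right_inverse[OF assms] assms
  unfolding invertible_mat_def inverts_mat_def by auto

text \<open>A two-sided inverse makes \<open>A\<close> a unit of the matrix ring, which excludes the
  outcome \<open>None\<close> of \<open>mat_inverse\<close>.\<close>

lemma the_mat_inverse: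
  fixes A :: "'a :: field mat"
  assumes "invertible_mat A" and "A \<in> carrier_mat n n"
  shows "the (mat_inverse A) \<in> carrier_mat n n"
    and "A * the (mat_inverse A) = 1\<^sub>m n"
    and "the (mat_inverse A) * A = 1\<^sub>m n"
proof -
  obtain B where B: "B \<in> carrier_mat n n" "A * B = 1\<^sub>m n" "B * A = 1\<^sub>m n"
    using invertible_mat_inverseE[OF assms] .
  have "A \<in> Units (ring_mat TYPE('a) n ())"
    using B assms(2) unfolding Units_def ring_mat_def by auto
  then obtain C where "mat_inverse A = Some C"
    using mat_inverse(1)[OF assms(2), of "()"] by (cases "mat_inverse A") auto
  with mat_inverse(2)[OF assms(2) this]
  show "the (mat_inverse A) \<in> carrier_mat n n" "A * the (mat_inverse A) = 1\<^sub>m n"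
    "the (mat_inverse A) * A = 1\<^sub>m n" by auto
qed

lemma det_nonzero_inverseE:
  fixes A :: "'a :: field mat"
  assumes "A \<in> carrier_mat n n" and "det A \<noteq> 0"
  obtains B where "B \<in> carrier_mat n n" "A * B = 1\<^sub>m n" "B * A = 1\<^sub>m n"
  using det_non_zero_imp_unit[OF assms, of undefined] that
  unfolding Units_def ring_mat_def by auto

text \<open>A left inverse makes \<open>A\<close> injective, so no nontrivial combination of its
  columns vanishes. Independence concerns the set of columns, hence the separate proof that no
  column is repeated.\<close>

lemma rank_eq_dim_col_if_left_inverse:
  fixes A :: "'a :: field mat"
  assumes A: "A \<in> carrier_mat n nc" and B: "B \<in> carrier_mat nc n" and BA: "B * A = 1\<^sub>m nc"
  shows "vec_space.rank n A = nc"
proof -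
  have "distinct (cols A)"
    unfolding distinct_conv_nth
  proof (intro allI impI notI)
    fix i j assume ij: "i < length (cols A)" "j < length (cols A)" "i \<noteq> j"
      and eq: "cols A ! i = cols A ! j"
    then have *: "i < nc" "j < nc" "col A i = col A j" using A by auto
    then have "col (B * A) i = col (B * A) j"
      using col_mult2[OF B A] by metis
    then have "col (1\<^sub>m nc :: 'a mat) i $ i = col (1\<^sub>m nc) j $ i" using BA by simp
    then show False using * ij by simp
  qed
  moreover have "module.lin_indpt class_ring (module_vec TYPE('a) n) (set (cols A))"
  proof (rule ccontr)
    assume "\<not> ?thesis"
    then obtain v where v: "v \<in> carrier_vec nc" "v \<noteq> 0\<^sub>v nc" "A *\<^sub>v v = 0\<^sub>v n"
      using vec_space.lin_depE[OF A] \<open>distinct (cols A)\<close> by blast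
    have "v = (B * A) *\<^sub>v v" using v BA by simp
    also have "\<dots> = B *\<^sub>v (A *\<^sub>v v)" using A B v by simp
    also have "\<dots> = 0\<^sub>v nc" using B v by auto
    finally show False using v by simp
  qed
  ultimately show ?thesis
    using vec_space.lin_indpt_full_rank[OF A] by blast
qed

section \<open>Column blocks, slices and mode-1 products of sums of outer products\<close>

lemma first_cols_carrier_iff [simp]: "first_cols k A \<in> carrier_mat m k \<longleftrightarrow> dim_row A = m"
  unfolding first_cols_def by auto

lemma first_cols_carrier: "A \<in> carrier_mat m n \<Longrightarrow> first_cols k A \<in> carrier_mat m k"
  by simp

lemma first_cols_mult:
  assumes "A \<in> carrier_mat m l" and "B \<in> carrier_mat l n" and "k \<le> n"
  shows "first_cols k (A * B) = A * first_cols k B"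
  using assms by (intro eq_matI) (auto simp: first_cols_def scalar_prod_def)

lemma first_cols_append_cols:
  "first_cols (dim_col A) (append_cols A C) = A"
  by (intro eq_matI) (auto simp: first_cols_def append_cols_def)

lemma append_cols_carrier:
  "A \<in> carrier_mat m k \<Longrightarrow> C \<in> carrier_mat m l \<Longrightarrow> append_cols A C \<in> carrier_mat m (k + l)"
  unfolding append_cols_def by auto

lemma frontal_slice_carrier [simp]: "frontal_slice m n F k \<in> carrier_mat m n"
  unfolding frontal_slice_def by simp

lemma cp_tensor_eq:
  assumes "A \<in> carrier_mat m r" and "B \<in> carrier_mat n r" and "C \<in> carrier_mat l r"
  shows "cp_tensor A B C = (\<lambda>i j k. if i < m \<and> j < n \<and> k < l
           then \<Sum>s<r. A $$ (i, s) * B $$ (j, s) * C $$ (k, s) else 0)"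
  using assms unfolding cp_tensor_def outer3_def by (intro ext) auto

lemma cp_tensor_in_tensor_carrier:
  assumes "A \<in> carrier_mat m r" and "B \<in> carrier_mat n r" and "C \<in> carrier_mat l r"
  shows "cp_tensor A B C \<in> tensor_carrier m n l"
  unfolding cp_tensor_eq[OF assms] tensor_carrier_def by auto

lemma tensor_eq_if_frontal_slices_eq:
  assumes "F \<in> tensor_carrier m n l" and "G \<in> tensor_carrier m n l"
    and "\<And>k. k < l \<Longrightarrow> frontal_slice m n F k = frontal_slice m n G k"
  shows "F = G"
proof (intro ext)
  fix i j k
  show "F i j k = G i j k"
  proof (cases "i < m \<and> j < n \<and> k < l")
    case True
    then show ?thesis
      using arg_cong[OF assms(3)[of k], of "\<lambda>M. M $$ (i, j)"] by (simp add: frontal_slice_def)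
  next
    case False
    then show ?thesis using assms(1,2) unfolding tensor_carrier_def by auto
  qed
qed

text \<open>The third factor enters a slice only through a diagonal matrix; this turns the tensor
  identities below into matrix identities.\<close>

lemma frontal_slice_cp_tensor:
  assumes "A \<in> carrier_mat m r" and "B \<in> carrier_mat n r" and "C \<in> carrier_mat l r"
    and "k < l"
  shows "frontal_slice m n (cp_tensor A B C) k =
    A * (mat_diag r (\<lambda>s. C $$ (k, s)) * B\<^sup>T)"
proof -
  have "mat_diag r (\<lambda>s. C $$ (k, s)) * B\<^sup>T = mat r n (\<lambda>(s, j). C $$ (k, s) * B $$ (j, s))"
    using assms by (subst mat_diag_mult_left[of _ r n]) auto
  then show ?thesis
    using assms unfolding cp_tensor_eq[OF assms(1-3)] frontal_slice_def
    by (intro eq_matI) (auto simp: scalar_prod_def atLeast0LessThan intro!: sum.cong)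
qed

text \<open>A mode-1 product acts on the first factor alone. Taking \<open>q\<close> below
  \<open>m\<close> covers the reduced tensor, where only the first r rows of that factor are
  seen.\<close>

lemma mode1_product_cp_tensor:
  assumes A: "A \<in> carrier_mat m r" and "B \<in> carrier_mat n r" and "C \<in> carrier_mat l r"
    and Q: "Q \<in> carrier_mat p q" and "q \<le> m"
  shows "mode1_product Q (cp_tensor A B C) =
    cp_tensor (Q * mat q r (\<lambda>(i, s). A $$ (i, s))) B C"
proof -
  have QA: "Q * mat q r (\<lambda>(i, s). A $$ (i, s)) \<in> carrier_mat p r" using Q by simp
  have "(\<Sum>x<q. Q $$ (i, x) * (\<Sum>s<r. A $$ (x, s) * B $$ (j, s) * C $$ (k, s))) =
      (\<Sum>s<r. (\<Sum>x<q. Q $$ (i, x) * A $$ (x, s)) * B $$ (j, s) * C $$ (k, s))" for i j k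
    by (simp add: sum_distrib_left sum_distrib_right mult.assoc) (rule sum.swap)
  then show ?thesis
    using assms unfolding cp_tensor_eq[OF assms(1-3)] cp_tensor_eq[OF QA assms(2,3)] mode1_product_def
    by (intro ext) (auto simp: scalar_prod_def atLeast0LessThan intro!: sum.cong)
qed

lemma mode1_product_cp_tensor_full:
  assumes "A \<in> carrier_mat m r" and "B \<in> carrier_mat n r" and "C \<in> carrier_mat l r"
    and "Q \<in> carrier_mat p m"
  shows "mode1_product Q (cp_tensor A B C) = cp_tensor (Q * A) B C"
proof -
  have "mat m r (\<lambda>(i, s). A $$ (i, s)) = A" using assms(1) by auto
  then show ?thesis using mode1_product_cp_tensor[OF assms order.refl] by simp
qed

text \<open>If a summand vanished, \<open>F\<close> would be a sum of fewer rank-one tensors.\<close>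

lemma tensor_decompositionI:
  assumes U: "U1 \<in> carrier_mat n1 r" "U2 \<in> carrier_mat n2 r" "U3 \<in> carrier_mat n3 r"
    and F: "F = cp_tensor U1 U2 U3" and rank: "tensor_rank n1 n2 n3 F = r"
  shows "tensor_decomposition n1 n2 n3 F U1 U2 U3"
proof -
  let ?G = "\<lambda>s. outer3 (col U1 s) (col U2 s) (col U3 s)"
  define I where "I = {s. s < r \<and> rank_one_tensor n1 n2 n3 (?G s)}"
  have [simp]: "finite I" unfolding I_def by simp
  have zero: "?G s i j k = 0" if "s < r" "s \<notin> I" for s i j k
  proof -
    have "col U1 s = 0\<^sub>v n1 \<or> col U2 s = 0\<^sub>v n2 \<or> col U3 s = 0\<^sub>v n3"
    proof (rule ccontr)
      assume "\<not> ?thesis"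
      then have "rank_one_tensor n1 n2 n3 (?G s)"
        unfolding rank_one_tensor_def using U
        by (intro exI[of _ "col U1 s"] exI[of _ "col U2 s"] exI[of _ "col U3 s"]) auto
      then show False using that unfolding I_def by simp
    qed
    then show ?thesis using U unfolding outer3_def by auto
  qed
  \<comment> \<open>\<open>tensor_rank\<close> counts summands indexed by an initial segment, so the
    surviving indices are renumbered.\<close>
  obtain h where h: "bij_betw h {..<card I} I"
    using ex_bij_betw_nat_finite[of I] by (auto simp: atLeast0LessThan)
  have "F = (\<lambda>i j k. \<Sum>s<card I. ?G (h s) i j k)"
  proof (intro ext)
    fix i j k
    have "F i j k = (\<Sum>s<r. ?G s i j k)" using F U by (simp add: cp_tensor_def)
    also have "\<dots> = (\<Sum>s\<in>I. ?G s i j k)"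
      by (rule sum.mono_neutral_right) (auto simp: I_def[symmetric] zero, auto simp: I_def)
    also have "\<dots> = (\<Sum>s<card I. ?G (h s) i j k)"
      by (rule sum.reindex_bij_betw[OF h, symmetric])
    finally show "F i j k = (\<Sum>s<card I. ?G (h s) i j k)" .
  qed
  moreover have "\<forall>s<card I. rank_one_tensor n1 n2 n3 (?G (h s))"
    using bij_betwE[OF h] unfolding I_def by auto
  ultimately have "tensor_rank n1 n2 n3 F \<le> card I"
    unfolding tensor_rank_def by (intro Least_le exI[of _ "\<lambda>s. ?G (h s)"]) blast
  moreover have "I \<subseteq> {..<r}" unfolding I_def by auto
  ultimately have "I = {..<r}"
    using rank by (intro card_seteq) auto
  then have "\<forall>s<r. rank_one_tensor n1 n2 n3 (?G s)" unfolding I_def by auto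
  then show ?thesis
    using U F rank unfolding tensor_decomposition_def Let_def by simp
qed

section \<open>The Khatri-Rao product and flattening\<close>

lemma khatri_rao_carrier:
  "B \<in> carrier_mat n r \<Longrightarrow> C \<in> carrier_mat l r \<Longrightarrow> khatri_rao B C \<in> carrier_mat (l * n) r"
  unfolding khatri_rao_def by auto

lemma khatri_rao_index:
  assumes "B \<in> carrier_mat n r" and "C \<in> carrier_mat l r" and "c < l * n" and "s < r"
  shows "khatri_rao B C $$ (c, s) = B $$ (c mod n, s) * C $$ (c div n, s)"
proof -
  \<comment> \<open>An index below \<open>l * n\<close> exists, so \<open>n\<close> is positive and
    \<open>mod\<close> and \<open>div\<close> decode it into a valid pair.\<close>
  have "0 < n" using assms(3) by (cases n) auto
  then have "c mod n < n" "c div n < l" using assms(3) by (auto simp: less_mult_imp_div_less)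
  then show ?thesis
    using assms unfolding khatri_rao_def kron_vec_def
    by (simp add: mat_of_cols_index)
qed

text \<open>Row \<open>c\<close> of the product carries the entries with second index
  \<open>c mod n\<close> and third index \<open>c div n\<close>, exactly as in the flattening; and
  flattening loses no entry of a tensor of this format.\<close>

lemma khatri_rao_mult_transpose_eq_iff:
  assumes A: "A \<in> carrier_mat m r" and B: "B \<in> carrier_mat n r" and C: "C \<in> carrier_mat l r"
    and F: "F \<in> tensor_carrier m n l"
  shows "khatri_rao B C * A\<^sup>T = (flatten1 m n l F)\<^sup>T \<longleftrightarrow> F = cp_tensor A B C"
proof -
  let ?G = "cp_tensor A B C"
  have prod: "khatri_rao B C * A\<^sup>T = (flatten1 m n l ?G)\<^sup>T"
  proof (rule eq_matI)
    fix c i assume "c < dim_row (flatten1 m n l ?G)\<^sup>T" "i < dim_col (flatten1 m n l ?G)\<^sup>T"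
    then have ci: "c < l * n" "i < m" by (auto simp: flatten1_def mult.commute)
    then have "0 < n" by (cases n) auto
    then have "c mod n < n" "c div n < l" using ci by (auto simp: less_mult_imp_div_less)
    then show "(khatri_rao B C * A\<^sup>T) $$ (c, i) = (flatten1 m n l ?G)\<^sup>T $$ (c, i)"
      using ci A khatri_rao_carrier[OF B C] khatri_rao_index[OF B C ci(1)]
      by (auto simp: flatten1_def mult.commute[of n] cp_tensor_eq[OF A B C] scalar_prod_def
          atLeast0LessThan ac_simps intro!: sum.cong)
  qed (use A khatri_rao_carrier[OF B C] in \<open>auto simp: flatten1_def\<close>)
  show ?thesis
  proof
    assume "khatri_rao B C * A\<^sup>T = (flatten1 m n l F)\<^sup>T"
    then have "(flatten1 m n l F)\<^sup>T\<^sup>T = (flatten1 m n l ?G)\<^sup>T\<^sup>T" using prod by simp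
    then have eq: "flatten1 m n l F = flatten1 m n l ?G" by (simp only: transpose_transpose)
    show "F = ?G"
    proof (rule tensor_eq_if_frontal_slices_eq[OF F cp_tensor_in_tensor_carrier[OF A B C]])
      fix k assume k: "k < l"
      show "frontal_slice m n F k = frontal_slice m n ?G k"
      proof (rule eq_matI)
        fix i j assume "i < dim_row (frontal_slice m n ?G k)" "j < dim_col (frontal_slice m n ?G k)"
        then have ij: "i < m" "j < n" by (auto simp: frontal_slice_def)
        \<comment> \<open>The pair (j, k) sits in column \<open>k * n + j\<close> of the flattening,
          which has to be in range.\<close>
        have "k * n + j < Suc k * n" using ij by simp
        also have "\<dots> \<le> l * n" using k by (intro mult_le_mono1) simp
        finally have c: "k * n + j < n * l" by (simp add: mult.commute)
        then show "frontal_slice m n F k $$ (i, j) = frontal_slice m n ?G k $$ (i, j)"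
          using arg_cong[OF eq, of "\<lambda>M. M $$ (i, k * n + j)"] ij
          by (simp add: flatten1_def frontal_slice_def)
      qed (auto simp: frontal_slice_def)
    qed
  qed (use prod in simp)
qed

section \<open>Least squares for consistent systems\<close>

lemma frobenius_norm_zero_mat: "frobenius_norm (0\<^sub>m m n) = 0"
  unfolding frobenius_norm_def by simp

lemma frobenius_norm_nonneg: "0 \<le> frobenius_norm A"
  unfolding frobenius_norm_def by (simp add: sum_nonneg)

lemma frobenius_norm_eq_zeroD:
  assumes "A \<in> carrier_mat m n" and "frobenius_norm A = 0"
  shows "A = 0\<^sub>m m n"
proof (rule eq_matI)
  have "(\<Sum>i<m. \<Sum>j<n. (cmod (A $$ (i, j)))\<^sup>2) = 0"
    using assms unfolding frobenius_norm_def by simp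
  then have "\<forall>i<m. (\<Sum>j<n. (cmod (A $$ (i, j)))\<^sup>2) = 0"
    by (subst (asm) sum_nonneg_eq_0_iff) (auto intro: sum_nonneg)
  then have "\<forall>i<m. \<forall>j<n. A $$ (i, j) = 0"
    by (simp add: sum_nonneg_eq_0_iff)
  then show "A $$ (i, j) = 0\<^sub>m m n $$ (i, j)" if "i < dim_row (0\<^sub>m m n)" "j < dim_col (0\<^sub>m m n)" for i j
    using that by simp
qed (use assms in auto)

text \<open>An exact solution has residual 0, so any minimiser has residual 0 too and is itself
  exact.\<close>

lemma least_squares_solution_consistent_iff:
  assumes A: "A \<in> carrier_mat m n" and B: "B \<in> carrier_mat m p"
    and X0: "X0 \<in> carrier_mat n p" "A * X0 = B"
  shows "least_squares_solution A B X \<longleftrightarrow> X \<in> carrier_mat n p \<and> A * X = B"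
proof -
  have z: "frobenius_norm (A * Y - B) = 0" if "A * Y = B" for Y
    using that B frobenius_norm_zero_mat by simp
  show ?thesis
  proof
    assume ls: "least_squares_solution A B X"
    then have X: "X \<in> carrier_mat n p" using A B unfolding least_squares_solution_def by simp
    have "frobenius_norm (A * X - B) \<le> frobenius_norm (A * X0 - B)"
      using ls A B X0(1) unfolding least_squares_solution_def by simp
    then have "frobenius_norm (A * X - B) = 0"
      using z[OF X0(2)] frobenius_norm_nonneg[of "A * X - B"] by simp
    then have *: "A * X - B = 0\<^sub>m m p"
      using A B X by (intro frobenius_norm_eq_zeroD) auto
    have "A * X = B"
    proof (rule eq_matI)
      fix i j assume "i < dim_row B" "j < dim_col B"
      then show "(A * X) $$ (i, j) = B $$ (i, j)"
        using arg_cong[OF *, of "\<lambda>M. M $$ (i, j)"] A B X by simp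
    qed (use A B X in auto)
    then show "X \<in> carrier_mat n p \<and> A * X = B" using X by simp
  next
    assume "X \<in> carrier_mat n p \<and> A * X = B"
    then show "least_squares_solution A B X"
      using A B z[of X] frobenius_norm_nonneg unfolding least_squares_solution_def by simp
  qed
qed

section \<open>The genericity polynomial\<close>

lemma factor_polys_sum:
  assumes "finite I" and "\<And>i. i \<in> I \<Longrightarrow> f i \<in> factor_polys n1 n2 n3 r"
  shows "(\<lambda>W. \<Sum>i\<in>I. f i W) \<in> factor_polys n1 n2 n3 r"
  using assms by (induction I rule: finite_induct) (auto intro: factor_polys.intros)

lemma factor_polys_prod:
  assumes "finite I" and "\<And>i. i \<in> I \<Longrightarrow> f i \<in> factor_polys n1 n2 n3 r"
  shows "(\<lambda>W. \<Prod>i\<in>I. f i W) \<in> factor_polys n1 n2 n3 r"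
  using assms by (induction I rule: finite_induct) (auto intro: factor_polys.intros)

text \<open>By the Leibniz formula; permutations keep the indices in range, so every entry occurring
  is covered by the assumption.\<close>

lemma factor_polys_det:
  assumes "\<And>i j. i < n \<Longrightarrow> j < n \<Longrightarrow> (\<lambda>W. f W i j) \<in> factor_polys n1 n2 n3 r"
  shows "(\<lambda>W. det (mat n n (\<lambda>(i, j). f W i j))) \<in> factor_polys n1 n2 n3 r"
proof -
  have less: "p i < n" if "p permutes {0..<n}" "i < n" for p :: "nat \<Rightarrow> nat" and i
    using permutes_in_image[OF that(1), of i] that(2) by simp
  have "det (mat n n (\<lambda>(i, j). f W i j)) =
      (\<Sum>p\<in>{p. p permutes {0..<n}}. signof p * (\<Prod>i\<in>{0..<n}. f W i (p i)))" for W
    by (subst det_def'[of _ n]) (auto intro!: sum.cong prod.cong simp: less)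
  then show ?thesis
    by (auto intro!: factor_polys_sum factor_polys_prod factor_polys.mult factor_polys.const
        assms simp: finite_permutations less)
qed

text \<open>Multiplying the three conditions into one polynomial makes the generic set the
  complement of a single hypersurface, and one point of nonvanishing shows that the conditions are
  compatible.\<close>

definition genericity_poly ::
  "nat \<Rightarrow> nat \<Rightarrow> complex mat \<times> complex mat \<times> complex mat \<Rightarrow> complex" where
  "genericity_poly n2 r W =
     det (mat r r (\<lambda>(i, s). fst W $$ (i, s))) *
     (det (mat n2 n2 (\<lambda>(i, s). fst (snd W) $$ (i, s))) *
     (\<Prod>s\<in>{..<r}. snd (snd W) $$ (0, s)))"

lemma genericity_poly_in_factor_polys:
  assumes "r \<le> n1" and "n2 \<le> r" and "1 \<le> n3"
  shows "genericity_poly n2 r \<in> factor_polys n1 n2 n3 r"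
proof -
  have 1: "(\<lambda>W. fst W $$ (i, s)) \<in> factor_polys n1 n2 n3 r" if "i < r" "s < r" for i s
    using factor_polys.coord1[of i n1 s r n2 n3] that assms by (simp add: case_prod_beta')
  have 2: "(\<lambda>W. fst (snd W) $$ (i, s)) \<in> factor_polys n1 n2 n3 r" if "i < n2" "s < n2" for i s
    using factor_polys.coord2[of i n2 s r n1 n3] that assms by (simp add: case_prod_beta')
  have 3: "(\<lambda>W. snd (snd W) $$ (0, s)) \<in> factor_polys n1 n2 n3 r" if "s < r" for s
    using factor_polys.coord3[of 0 n3 s r n1 n2] that assms by (simp add: case_prod_beta')
  show ?thesis
    unfolding genericity_poly_def[abs_def]
    by (intro factor_polys.mult factor_polys_det factor_polys_prod 1 2 3) auto
qed

text \<open>Truncated identities and an all-ones matrix give each of the three factors the value 1;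
  this makes the open set nonempty.\<close>

lemma genericity_poly_witness:
  assumes "r \<le> n1" and "n2 \<le> r" and "1 \<le> n3"
  shows "genericity_poly n2 r
    (mat n1 r (\<lambda>(i, s). if i = s then 1 else 0), mat n2 r (\<lambda>(i, s). if i = s then 1 else 0),
     mat n3 r (\<lambda>_. 1)) \<noteq> 0"
proof -
  have "mat r r (\<lambda>(i, s). mat n1 r (\<lambda>(i, s). if i = s then 1 else 0) $$ (i, s)) = (1\<^sub>m r :: complex mat)"
    using assms by (intro eq_matI) auto
  moreover have "mat n2 n2 (\<lambda>(i, s). mat n2 r (\<lambda>(i, s). if i = s then 1 else 0) $$ (i, s)) =
      (1\<^sub>m n2 :: complex mat)"
    using assms by (intro eq_matI) auto
  ultimately show ?thesis using assms by (simp add: genericity_poly_def)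
qed

section \<open>Slices of a tensor with generic factors\<close>

lemma mult_mat_inverse:
  fixes A :: "'a :: semiring_1 mat"
  assumes A: "A \<in> carrier_mat n n" and A': "A' \<in> carrier_mat n n" and AA': "A * A' = 1\<^sub>m n"
    and B: "B \<in> carrier_mat n n" and B': "B' \<in> carrier_mat n n" and BB': "B * B' = 1\<^sub>m n"
  shows "(A * B) * (B' * A') = 1\<^sub>m n"
proof -
  have "(A * B) * (B' * A') = A * (B * (B' * A'))"
    by (rule assoc_mult_mat[OF A B mult_carrier_mat[OF B' A']])
  also have "B * (B' * A') = (B * B') * A'"
    by (rule assoc_mult_mat[OF B B' A', symmetric])
  also have "A * \<dots> = 1\<^sub>m n" using A' AA' BB' by simp
  finally show ?thesis .
qed

lemma frontal_slice_mode1_product: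
  assumes "Q \<in> carrier_mat p q"
  shows "frontal_slice p n (mode1_product Q F) k = Q * frontal_slice q n F k"
  using assms unfolding frontal_slice_def mode1_product_def
  by (intro eq_matI) (auto simp: scalar_prod_def atLeast0LessThan)

locale generic_cp_tensor =
  fixes n1 n2 n3 r :: nat and W1 W2 W3 :: "complex mat" and F :: tensor3
  assumes W1: "W1 \<in> carrier_mat n1 r"
    and W2: "W2 \<in> carrier_mat n2 r"
    and W3: "W3 \<in> carrier_mat n3 r"
    and n2_le_r: "n2 \<le> r" and r_le_n1: "r \<le> n1" and n3_ge_1: "1 \<le> n3"
    and F: "F = cp_tensor W1 W2 W3"
    and generic: "genericity_poly n2 r (W1, W2, W3) \<noteq> 0"
begin

definition top_block :: "complex mat" where
  "top_block = mat r r (\<lambda>(i, s). W1 $$ (i, s))"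

lemma top_block_carrier: "top_block \<in> carrier_mat r r"
  unfolding top_block_def by simp

lemma top_block_inverseE:
  obtains B where "B \<in> carrier_mat r r" "top_block * B = 1\<^sub>m r" "B * top_block = 1\<^sub>m r"
proof -
  have "det top_block \<noteq> 0"
    using generic unfolding genericity_poly_def top_block_def by simp
  then show thesis using det_nonzero_inverseE[OF top_block_carrier] that by blast
qed

lemma W3_row0_nonzero: "s < r \<Longrightarrow> W3 $$ (0, s) \<noteq> 0"
  using generic unfolding genericity_poly_def by auto

lemma W2_left_inverseE:
  obtains L where "L \<in> carrier_mat n2 r" "L * W2\<^sup>T = 1\<^sub>m n2"
proof -
  \<comment> \<open>Multiplying by \<open>?J\<close> on the right selects the first n2 columns of
    \<open>W2\<close>, so \<open>?J * E\<close>, the inverse \<open>E\<close> of that block padded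
    with zero rows, is a right inverse of \<open>W2\<close>. Its transpose is the required
    \<open>L\<close>.\<close>
  let ?J = "first_cols n2 (1\<^sub>m r :: complex mat)"
  let ?M = "mat n2 n2 (\<lambda>(i, s). W2 $$ (i, s))"
  have M: "?M \<in> carrier_mat n2 n2" by simp
  have "det ?M \<noteq> 0" using generic unfolding genericity_poly_def by simp
  then obtain E where E: "E \<in> carrier_mat n2 n2" "?M * E = 1\<^sub>m n2"
    using det_nonzero_inverseE[OF M] by blast
  have J: "?J \<in> carrier_mat r n2" by simp
  have JE: "?J * E \<in> carrier_mat r n2" by (rule mult_carrier_mat[OF J E(1)])
  have "W2 * ?J = first_cols n2 (W2 * 1\<^sub>m r)"
    using first_cols_mult[OF W2 one_carrier_mat n2_le_r] by simp
  also have "\<dots> = ?M" using W2 by (intro eq_matI) (auto simp: first_cols_def)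
  finally have "W2 * (?J * E) = 1\<^sub>m n2" using assoc_mult_mat[OF W2 J E(1)] E(2) by simp
  then have "(W2 * (?J * E))\<^sup>T = 1\<^sub>m n2" by simp
  then have "(?J * E)\<^sup>T * W2\<^sup>T = 1\<^sub>m n2"
    using transpose_mult[OF W2 JE] by simp
  moreover have "(?J * E)\<^sup>T \<in> carrier_mat n2 r" using JE by simp
  ultimately show thesis using that by blast
qed

lemma frontal_slice_F:
  assumes "k < n3"
  shows "frontal_slice r n2 F k = top_block * (mat_diag r (\<lambda>s. W3 $$ (k, s)) * W2\<^sup>T)"
proof -
  have "frontal_slice r n2 F k = frontal_slice r n2 (cp_tensor top_block W2 W3) k"
    using assms r_le_n1
    unfolding F cp_tensor_eq[OF W1 W2 W3] cp_tensor_eq[OF top_block_carrier W2 W3]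
      frontal_slice_def
    by (intro eq_matI) (auto simp: top_block_def)
  then show ?thesis
    using frontal_slice_cp_tensor[OF top_block_carrier W2 W3 assms] by simp
qed

lemma mat_diag_W3_row0_inverse:
  "mat_diag r (\<lambda>s. inverse (W3 $$ (0, s))) * mat_diag r (\<lambda>s. W3 $$ (0, s)) = 1\<^sub>m r"
proof -
  have "mat_diag r (\<lambda>s. inverse (W3 $$ (0, s)) * W3 $$ (0, s)) = 1\<^sub>m r"
    using W3_row0_nonzero by (intro eq_matI) (auto simp: mat_diag_def)
  then show ?thesis by simp
qed

text \<open>The left inverses of the three factors of slice 0 multiply, in reverse order, to a left
  inverse of the slice.\<close>

lemma rank_frontal_slice: "vec_space.rank r (frontal_slice r n2 F 0) = n2"
proof -
  obtain A' where A': "A' \<in> carrier_mat r r" "A' * top_block = 1\<^sub>m r"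
    using top_block_inverseE by blast
  obtain L where L: "L \<in> carrier_mat n2 r" "L * W2\<^sup>T = 1\<^sub>m n2"
    using W2_left_inverseE .
  let ?d = "mat_diag r (\<lambda>s. W3 $$ (0, s))"
  let ?d' = "mat_diag r (\<lambda>s. inverse (W3 $$ (0, s)))"
  have W2': "W2\<^sup>T \<in> carrier_mat r n2" using W2 by simp
  have dW: "?d * W2\<^sup>T \<in> carrier_mat r n2"
    using W2' by (intro mult_carrier_mat[of _ _ r]) auto
  have d'A': "?d' * A' \<in> carrier_mat r r"
    using A'(1) by (intro mult_carrier_mat[of _ _ r]) auto
  have "A' * (top_block * (?d * W2\<^sup>T)) = ?d * W2\<^sup>T"
    using assoc_mult_mat[OF A'(1) top_block_carrier dW] left_mult_one_mat[OF dW] A'(2) by metis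
  then have "(?d' * A') * (top_block * (?d * W2\<^sup>T)) = ?d' * (?d * W2\<^sup>T)"
    using assoc_mult_mat[OF mat_diag_dim A'(1), of "top_block * (?d * W2\<^sup>T)" n2]
      mult_carrier_mat[OF top_block_carrier dW] by simp
  also have "\<dots> = (?d' * ?d) * W2\<^sup>T"
    by (rule assoc_mult_mat[OF mat_diag_dim mat_diag_dim W2', symmetric])
  also have "\<dots> = W2\<^sup>T"
    unfolding mat_diag_W3_row0_inverse by (rule left_mult_one_mat[OF W2'])
  finally have "(?d' * A') * frontal_slice r n2 F 0 = W2\<^sup>T"
    using frontal_slice_F[of 0] n3_ge_1 by simp
  then have "(L * (?d' * A')) * frontal_slice r n2 F 0 = 1\<^sub>m n2"
    using assoc_mult_mat[OF L(1) d'A' frontal_slice_carrier] L(2) by metis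
  then show ?thesis
    by (rule rank_eq_dim_col_if_left_inverse[OF frontal_slice_carrier mult_carrier_mat[OF L(1) d'A']])
qed

section \<open>The reduced tensor and its common eigenmatrices\<close>

text \<open>Slice 0 of F consists of the first n2 columns of \<open>F_hat\<close>, so its inverse
  \<open>P\<close> maps it to the first n2 columns of the identity. The matrix \<open>P'\<close> is
  \<open>F_hat\<close> itself.\<close>

lemma reduced_tensorE:
  assumes C: "C \<in> carrier_mat r (r - n2)" and inv: "invertible_mat (F_hat r n2 F C)"
  obtains P P' where "P \<in> carrier_mat r r" "P' \<in> carrier_mat r r" "P' * P = 1\<^sub>m r" "P * P' = 1\<^sub>m r"
    "reduced_tensor r n2 F C = cp_tensor (P * top_block) W2 W3"
    "frontal_slice r n2 (reduced_tensor r n2 F C) 0 = first_cols n2 (1\<^sub>m r)"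
proof -
  let ?H = "F_hat r n2 F C"
  let ?P = "the (mat_inverse ?H)"
  have H: "?H \<in> carrier_mat r r"
    using append_cols_carrier[OF frontal_slice_carrier C, of n2 F 0] n2_le_r
    unfolding F_hat_def by simp
  note P = the_mat_inverse[OF inv H]
  have "first_cols n2 ?H = frontal_slice r n2 F 0"
    using first_cols_append_cols[of "frontal_slice r n2 F 0" C]
    unfolding F_hat_def by (simp add: frontal_slice_def)
  then have "first_cols n2 (?P * ?H) = ?P * frontal_slice r n2 F 0"
    using first_cols_mult[OF P(1) H n2_le_r] by simp
  then have "frontal_slice r n2 (reduced_tensor r n2 F C) 0 = first_cols n2 (1\<^sub>m r)"
    unfolding reduced_tensor_def frontal_slice_mode1_product[OF P(1)] P(3) by simp
  moreover have "reduced_tensor r n2 F C = cp_tensor (?P * top_block) W2 W3"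
    unfolding reduced_tensor_def F top_block_def
    using mode1_product_cp_tensor[OF W1 W2 W3 P(1)[unfolded F] r_le_n1] .
  ultimately show thesis using that[OF P(1) H P(2,3)] by blast
qed

text \<open>The eigenmatrix relation says that \<open>S\<close> transforms the reduced tensor into the tensor
  with factors \<open>1\<close>, \<open>U2\<close>, \<open>U3\<close>. Undoing \<open>S\<close> and the reduction in the first mode recovers \<open>F\<close>,
  since all rows of \<open>W1\<close> are combinations of its first \<open>r\<close> rows.\<close>

lemma decomposition_of_eigenmatrix:
  fixes D :: "nat \<Rightarrow> complex mat"
  assumes C: "C \<in> carrier_mat r (r - n2)" and inv: "invertible_mat (F_hat r n2 F C)"
    and S: "S \<in> carrier_mat r r" and invS: "invertible_mat S"
    and eig: "eigenmatrix_relation r n2 {1..<n3}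
      (frontal_slice r n2 (reduced_tensor r n2 F C)) S D"
  obtains U1 where "U1 \<in> carrier_mat n1 r"
    "F = cp_tensor U1 (first_cols n2 S)\<^sup>T
      (mat n3 r (\<lambda>(k, i). if k = 0 then 1 else D k $$ (i, i)))"
proof -
  let ?T = "reduced_tensor r n2 F C"
  let ?U2 = "(first_cols n2 S)\<^sup>T"
  let ?U3 = "mat n3 r (\<lambda>(k, i). if k = 0 then 1 else D k $$ (i, i))"
  obtain P P' where P: "P \<in> carrier_mat r r" "P' \<in> carrier_mat r r" "P' * P = 1\<^sub>m r"
    "?T = cp_tensor (P * top_block) W2 W3"
    "frontal_slice r n2 ?T 0 = first_cols n2 (1\<^sub>m r)"
    using reduced_tensorE[OF C inv] by metis
  obtain S' where S': "S' \<in> carrier_mat r r" "S' * S = 1\<^sub>m r"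
    using invertible_mat_inverseE[OF invS S] .
  obtain A' where A': "A' \<in> carrier_mat r r" "A' * top_block = 1\<^sub>m r"
    using top_block_inverseE by blast
  have PA: "P * top_block \<in> carrier_mat r r"
    using P(1) top_block_carrier by auto
  have U2: "?U2 \<in> carrier_mat n2 r" using S by simp
  have U3: "?U3 \<in> carrier_mat n3 r" by simp
  have SPA: "S * (P * top_block) \<in> carrier_mat r r" using S PA by auto
  have "cp_tensor (S * (P * top_block)) W2 W3 = cp_tensor (1\<^sub>m r) ?U2 ?U3"
  proof (rule tensor_eq_if_frontal_slices_eq[of _ r n2 n3])
    fix k assume k: "k < n3"
    have "frontal_slice r n2 (cp_tensor (S * (P * top_block)) W2 W3) k = S * frontal_slice r n2 ?T k"
      using mode1_product_cp_tensor_full[OF PA W2 W3 S] frontal_slice_mode1_product[OF S, of n2 ?T k] P(4)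
      by simp
    also have "\<dots> = mat_diag r (\<lambda>s. ?U3 $$ (k, s)) * first_cols n2 S"
    proof (cases "k = 0")
      case True
      \<comment> \<open>The row of ones in \<open>?U3\<close> fits slice 0: there \<open>S\<close>
        times the truncated identity is just the first n2 columns of \<open>S\<close>.\<close>
      have "mat_diag r (\<lambda>s. ?U3 $$ (k, s)) = 1\<^sub>m r"
        using True k by (intro eq_matI) (auto simp: mat_diag_def)
      moreover have "S * first_cols n2 (1\<^sub>m r) = first_cols n2 S"
        using first_cols_mult[OF S one_carrier_mat n2_le_r] S by simp
      ultimately show ?thesis
        using True P(5) left_mult_one_mat[OF first_cols_carrier[OF S, of n2]] by simp
    next
      case False
      then have "k \<in> {1..<n3}" using k by simp
      then have D: "D k \<in> carrier_mat r r" "diagonal_mat (D k)"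
        "S * frontal_slice r n2 ?T k = D k * first_cols n2 S"
        using eig unfolding eigenmatrix_relation_def by blast+
      have "mat_diag r (\<lambda>s. ?U3 $$ (k, s)) = D k"
        using False k D(1,2) by (intro eq_matI) (auto simp: mat_diag_def diagonal_mat_def)
      then show ?thesis using D(3) by simp
    qed
    also have "\<dots> = frontal_slice r n2 (cp_tensor (1\<^sub>m r) ?U2 ?U3) k"
      unfolding frontal_slice_cp_tensor[OF one_carrier_mat U2 U3 k]
        transpose_transpose
      by (rule left_mult_one_mat[OF mult_carrier_mat[OF mat_diag_dim first_cols_carrier[OF S]], symmetric])
    finally show "frontal_slice r n2 (cp_tensor (S * (P * top_block)) W2 W3) k =
        frontal_slice r n2 (cp_tensor (1\<^sub>m r) ?U2 ?U3) k" .
  qed (rule cp_tensor_in_tensor_carrier[OF SPA W2 W3] cp_tensor_in_tensor_carrier[OF one_carrier_mat U2 U3])+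
  \<comment> \<open>\<open>Q\<close> is \<open>W1\<close> times the inverse of
    \<open>S * (P * top_block)\<close>, so it carries that first factor back to
    \<open>W1\<close>.\<close>
  moreover define Q where "Q = W1 * ((A' * P') * S')"
  have A'P': "A' * P' \<in> carrier_mat r r" using A' P by auto
  have A'P'S': "(A' * P') * S' \<in> carrier_mat r r" using A'P' S' by auto
  have Q: "Q \<in> carrier_mat n1 r" unfolding Q_def using W1 A'P'S' by auto
  have "(A' * P') * (P * top_block) = 1\<^sub>m r"
    by (rule mult_mat_inverse[OF A'(1) top_block_carrier A'(2) P(2,1,3)])
  then have "((A' * P') * S') * (S * (P * top_block)) = 1\<^sub>m r"
    by (rule mult_mat_inverse[OF A'P' PA _ S'(1) S S'(2)])
  then have "Q * (S * (P * top_block)) = W1"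
    unfolding Q_def using assoc_mult_mat[OF W1 A'P'S' SPA] W1 by simp
  ultimately have "F = cp_tensor (Q * 1\<^sub>m r) ?U2 ?U3"
    using mode1_product_cp_tensor_full[OF SPA W2 W3 Q]
      mode1_product_cp_tensor_full[OF one_carrier_mat U2 U3 Q] F by simp
  then show thesis using that[OF Q] Q by simp
qed

text \<open>The eigenmatrix comes from the generic factors \<open>W1\<close>, \<open>W2\<close>, \<open>W3\<close>: other
  decompositions of \<open>F\<close> may have zeros in the first row of their third factor.\<close>

lemma eigenmatrix_exists:
  assumes C: "C \<in> carrier_mat r (r - n2)" and inv: "invertible_mat (F_hat r n2 F C)"
  obtains S where "gen_left_common_eigenmatrix r n2 {1..<n3}
      (frontal_slice r n2 (reduced_tensor r n2 F C)) S"
    "invertible_mat S"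
proof -
  let ?T = "frontal_slice r n2 (reduced_tensor r n2 F C)"
  obtain P P' where P: "P \<in> carrier_mat r r" "P' \<in> carrier_mat r r" "P' * P = 1\<^sub>m r"
    "reduced_tensor r n2 F C = cp_tensor (P * top_block) W2 W3"
    "?T 0 = first_cols n2 (1\<^sub>m r)"
    using reduced_tensorE[OF C inv] by metis
  obtain A' where A': "A' \<in> carrier_mat r r" "A' * top_block = 1\<^sub>m r"
    using top_block_inverseE by blast
  let ?d = "\<lambda>k. mat_diag r (\<lambda>s. W3 $$ (k, s))"
  let ?d' = "mat_diag r (\<lambda>s. inverse (W3 $$ (0, s)))"
  define B where "B = P * top_block"
  define B' where "B' = A' * P'"
  have B: "B \<in> carrier_mat r r" and B': "B' \<in> carrier_mat r r"
    unfolding B_def B'_def using P(1,2) A'(1) top_block_carrier by auto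
  have B'B: "B' * B = 1\<^sub>m r"
    unfolding B_def B'_def by (rule mult_mat_inverse[OF A'(1) top_block_carrier A'(2) P(2,1,3)])
  \<comment> \<open>The factor \<open>?d'\<close> normalises row 0 of \<open>W3\<close> to ones;
    with it \<open>S * ?T 0\<close>, the first n2 columns of \<open>S\<close>, becomes the transpose
    of \<open>W2\<close>, and the eigenvalues become the ratios of row k to row 0.\<close>
  define S where "S = ?d' * B'"
  have S: "S \<in> carrier_mat r r" unfolding S_def using B' by (intro mult_carrier_mat[of _ _ r]) auto
  have Bd: "B * ?d 0 \<in> carrier_mat r r" using B by (intro mult_carrier_mat[of _ _ r]) auto
  have SBd: "S * (B * ?d 0) = 1\<^sub>m r"
    unfolding S_def by (rule mult_mat_inverse[OF mat_diag_dim mat_diag_dim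
          mat_diag_W3_row0_inverse B' B B'B])
  have W2': "W2\<^sup>T \<in> carrier_mat r n2" using W2 by simp
  have ST: "S * ?T k = (?d' * ?d k) * W2\<^sup>T" if "k < n3" for k
  proof -
    have dW: "?d k * W2\<^sup>T \<in> carrier_mat r n2" by (rule mult_carrier_mat[OF mat_diag_dim W2'])
    have "S * ?T k = S * (B * (?d k * W2\<^sup>T))"
      unfolding P(4) B_def[symmetric] frontal_slice_cp_tensor[OF B W2 W3 that] ..
    also have "\<dots> = ?d' * (B' * (B * (?d k * W2\<^sup>T)))"
      unfolding S_def by (rule assoc_mult_mat[OF mat_diag_dim B' mult_carrier_mat[OF B dW]])
    also have "B' * (B * (?d k * W2\<^sup>T)) = ?d k * W2\<^sup>T"
      using assoc_mult_mat[OF B' B dW] left_mult_one_mat[OF dW] B'B by metis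
    also have "?d' * (?d k * W2\<^sup>T) = (?d' * ?d k) * W2\<^sup>T"
      by (rule assoc_mult_mat[OF mat_diag_dim mat_diag_dim W2', symmetric])
    finally show ?thesis .
  qed
  have "first_cols n2 S = S * ?T 0"
    using first_cols_mult[OF S one_carrier_mat n2_le_r] S P(5) by simp
  also have "\<dots> = W2\<^sup>T"
    using ST[of 0] n3_ge_1 mat_diag_W3_row0_inverse W2' by simp
  finally have fS: "first_cols n2 S = W2\<^sup>T" .
  have diag: "diagonal_mat (mat_diag r f)" for f :: "nat \<Rightarrow> complex"
    by (auto simp: mat_diag_def diagonal_mat_def)
  have "eigenmatrix_relation r n2 {1..<n3} ?T S (\<lambda>k. ?d' * ?d k)"
    unfolding eigenmatrix_relation_def fS using ST diag by auto
  moreover have "vec_space.rank r S = r"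
    using mat_mult_left_right_inverse[OF S Bd SBd] by (rule rank_eq_dim_col_if_left_inverse[OF S Bd])
  ultimately have "gen_left_common_eigenmatrix r n2 {1..<n3} ?T S"
    unfolding gen_left_common_eigenmatrix_def using S by blast
  then show thesis using that invertible_matI[OF S Bd SBd] by blast
qed

text \<open>The decomposition recovered from \<open>S\<close> makes the system consistent, so its
  least squares solutions are the first factors that complete \<open>U2\<close> and
  \<open>U3\<close> to F. That F has rank r then excludes vanishing summands.\<close>

lemma least_squares_decomposition:
  fixes D :: "nat \<Rightarrow> complex mat"
  assumes rank: "tensor_rank n1 n2 n3 F = r"
    and C: "C \<in> carrier_mat r (r - n2)" and inv: "invertible_mat (F_hat r n2 F C)"
    and S: "S \<in> carrier_mat r r" and invS: "invertible_mat S"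
    and eig: "eigenmatrix_relation r n2 {1..<n3}
      (frontal_slice r n2 (reduced_tensor r n2 F C)) S D"
  defines "U2 \<equiv> (first_cols n2 S)\<^sup>T"
    and "U3 \<equiv> mat n3 r (\<lambda>(k, i). if k = 0 then 1 else D k $$ (i, i))"
  defines "LS \<equiv> \<lambda>X. X \<in> carrier_mat n1 r \<and>
    least_squares_solution (khatri_rao U2 U3) ((flatten1 n1 n2 n3 F)\<^sup>T) (X\<^sup>T)"
  shows "\<exists>X. LS X" and "LS X \<Longrightarrow> tensor_decomposition n1 n2 n3 F X U2 U3"
proof -
  obtain U1 where U1: "U1 \<in> carrier_mat n1 r" and FU: "F = cp_tensor U1 U2 U3"
    using decomposition_of_eigenmatrix[OF C inv S invS eig] unfolding U2_def U3_def .
  have U2: "U2 \<in> carrier_mat n2 r" and U3: "U3 \<in> carrier_mat n3 r"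
    using S unfolding U2_def U3_def by simp_all
  have Fc: "F \<in> tensor_carrier n1 n2 n3" unfolding F by (rule cp_tensor_in_tensor_carrier[OF W1 W2 W3])
  have fl: "(flatten1 n1 n2 n3 F)\<^sup>T \<in> carrier_mat (n3 * n2) n1"
    unfolding flatten1_def by (simp add: mult.commute)
  have U1': "U1\<^sup>T \<in> carrier_mat r n1" using U1 by simp
  have "khatri_rao U2 U3 * U1\<^sup>T = (flatten1 n1 n2 n3 F)\<^sup>T"
    using khatri_rao_mult_transpose_eq_iff[OF U1 U2 U3 Fc] FU by simp
  note exact = least_squares_solution_consistent_iff[OF khatri_rao_carrier[OF U2 U3] fl U1' this]
  have LS_iff: "LS X \<longleftrightarrow> X \<in> carrier_mat n1 r \<and> F = cp_tensor X U2 U3" for X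
    using exact[of "X\<^sup>T"] khatri_rao_mult_transpose_eq_iff[OF _ U2 U3 Fc, of X]
    unfolding LS_def by auto
  show "\<exists>X. LS X" using LS_iff U1 FU by blast
  show "tensor_decomposition n1 n2 n3 F X U2 U3" if "LS X"
    using LS_iff that tensor_decompositionI[OF _ U2 U3 _ rank] by blast
qed

end

section \<open>Assembly over the Zariski open set\<close>

theorem theorem3p2:
  fixes n1 n2 n3 r :: nat
  assumes "n1 \<ge> n2" and "n2 \<ge> n3" and "n3 \<ge> 1" and "n2 < r" and "r \<le> n1"
  shows "\<exists>U. zariski_open n1 n2 n3 r U \<and> U \<noteq> {} \<and>
    (\<forall>W1 W2 W3. \<forall>F \<in> tensor_carrier n1 n2 n3.
      (W1, W2, W3) \<in> U \<and> F = cp_tensor W1 W2 W3 \<and> tensor_rank n1 n2 n3 F = r \<longrightarrow>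
      vec_space.rank r (frontal_slice r n2 F 0) = n2 \<and>
      (\<forall>C \<in> carrier_mat r (r - n2). invertible_mat (F_hat r n2 F C) \<longrightarrow>
        (let T = frontal_slice r n2 (reduced_tensor r n2 F C) in
          (\<forall>S D. gen_left_common_eigenmatrix r n2 {1..<n3} T S \<and> invertible_mat S \<and>
                 eigenmatrix_relation r n2 {1..<n3} T S D \<longrightarrow>
            (let U2 = transpose_mat (first_cols n2 S);
                 U3 = mat n3 r (\<lambda>(k, i). if k = 0 then 1 else D k $$ (i, i));
                 LS = (\<lambda>U1. U1 \<in> carrier_mat n1 r \<and>
                        least_squares_solution (khatri_rao U2 U3)
                          (transpose_mat (flatten1 n1 n2 n3 F)) (transpose_mat U1))
             in (\<exists>U1. LS U1) \<and>
                (\<forall>U1. LS U1 \<longrightarrow> tensor_decomposition n1 n2 n3 F U1 U2 U3))) \<and>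
          (\<forall>V1 V2 V3. tensor_decomposition n1 n2 n3 F V1 V2 V3 \<longrightarrow>
            (\<exists>S. gen_left_common_eigenmatrix r n2 {1..<n3} T S \<and> invertible_mat S)))))"
proof -
  \<comment> \<open>The set is written with a singleton family of polynomials to match
    \<open>zariski_open\<close>.\<close>
  let ?U = "factor_space n1 n2 n3 r - {W. \<forall>p\<in>{genericity_poly n2 r}. p W = 0}"
  have n: "n2 \<le> r" "r \<le> n1" "1 \<le> n3" using assms by simp_all
  have generic: "generic_cp_tensor n1 n2 n3 r W1 W2 W3 F"
    if "(W1, W2, W3) \<in> ?U \<and> F = cp_tensor W1 W2 W3 \<and> tensor_rank n1 n2 n3 F = r"
    for W1 W2 W3 F
    using that n by unfold_locales (simp_all add: factor_space_def)
  have eig: "S \<in> carrier_mat r r" if "gen_left_common_eigenmatrix r n2 K T S" for K T S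
    using that unfolding gen_left_common_eigenmatrix_def by blast
  show ?thesis
    unfolding Let_def
  proof (intro exI[of _ ?U] conjI allI ballI impI, goal_cases)
    case 1
    show ?case
      unfolding zariski_open_def
      using genericity_poly_in_factor_polys[OF n(2,1,3)]
      by (intro exI[of _ "{genericity_poly n2 r}"]) simp
  next
    case 2
    have "(mat n1 r (\<lambda>(i, s). if i = s then 1 else 0), mat n2 r (\<lambda>(i, s). if i = s then 1 else 0),
        mat n3 r (\<lambda>_. 1)) \<in> ?U"
      using genericity_poly_witness[OF n(2,1,3)] by (simp add: factor_space_def)
    then show ?case by blast
  next
    case (3 W1 W2 W3 F)
    then show ?case using generic_cp_tensor.rank_frontal_slice[OF generic] by blast
  next
    case (4 W1 W2 W3 F C S D)
    show ?case
      using generic_cp_tensor.least_squares_decomposition(1)[OF generic[OF 4(2)] _ 4(3,4) eig, of _ _ S D] 4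
      by blast
  next
    case (5 W1 W2 W3 F C S D U1)
    show ?case
      using generic_cp_tensor.least_squares_decomposition(2)[OF generic[OF 5(2)] _ 5(3,4) eig, of _ _ S D] 5
      by blast
  next
    case (6 W1 W2 W3 F C)
    show ?case
      using generic_cp_tensor.eigenmatrix_exists[OF generic[OF 6(2)] 6(3,4)] by blast
  qed
qed

end
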